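(* Let $\Lambda_1$ be a unital quantum channel acting on a qubit, let $\Lambda_2$ be an arbitrary quantum channel acting on a qubit, and let $\widetilde{\Lambda}$ be a completely positive map on qubit operators (not necessarily trace preserving). If the map $\mathbb{1}\otimes(\Lambda_2\circ\widetilde{\Lambda}\circ\Lambda_1)$ preserves entanglement for some two-qubit input state (i.e. it is not entanglement-annihilating), then the product channel $\Lambda_1\otimes\Lambda_2$ also preserves entanglement for some two-qubit input state (i.e. it is not entanglement-annihilating).
   Context: A qubit channel is a completely positive trace-preserving (CPTP) linear map on the complex $2\times 2$ matrices; it is unital if it maps the identity matrix to itself. $\mathbb{1}$ in a tensor product of maps denotes the identity map. A positive semidefinite operator on $\mathbb{C}^2\otimes\mathbb{C}^2$ (possibly unnormalized) is separable if it is a finite sum $\sum_i S_i\otimes D_i$ with $S_i,D_i$ positive semidefinite, and entangled otherwise. A map $\Phi_1\otimes\Phi_2$ with $\Phi_1,\Phi_2$ completely positive is entanglement-annihilating (EA) if for every bipartite input state $|\psi\rangle$ the output $(\Phi_1\otimes\Phi_2)(|\psi\rangle\langle\psi|)$ is separable; it "preserves entanglement for some input state" if it is not EA, i.e. some input state has an entangled output. *)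

theory Defs
  imports "HOL-Analysis.Analysis"
begin

type_synonym qubit_op = "complex^2^2"
type_synonym two_qubit_op = "complex^(2 \<times> 2)^(2 \<times> 2)"

text \<open>The library's \<open>(*s)\<close> scales vectors by entries of their own component type, so on
  matrices it does not give multiplication by a complex scalar.\<close>

definition smat :: "complex \<Rightarrow> complex^'n^'m \<Rightarrow> complex^'n^'m"
  where "smat c A = (\<chi> i j. c * A $ i $ j)"

lemma vector_space_smat: "vector_space smat"
  by unfold_locales (simp_all add: smat_def vec_eq_iff algebra_simps)

definition kron :: "complex^'n^'m \<Rightarrow> complex^'q^'p \<Rightarrow> complex^('n \<times> 'q)^('m \<times> 'p)"
  where "kron A B = (\<chi> i j. A $ fst i $ fst j * B $ snd i $ snd j)"

definition mat_unit :: "'m \<Rightarrow> 'n \<Rightarrow> complex^'n^'m"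
  where "mat_unit i j = (\<chi> a b. if a = i \<and> b = j then 1 else 0)"

definition ketbra :: "complex^'n \<Rightarrow> complex^'n^'n"
  where "ketbra \<psi> = (\<chi> i j. \<psi> $ i * cnj (\<psi> $ j))"

text \<open>Positive semidefiniteness over an arbitrary finite index set; the set is explicit so that
  the dimension of the ancilla in \<open>completely_positive\<close> can be quantified.\<close>

definition psd_on :: "'i set \<Rightarrow> ('i \<Rightarrow> 'i \<Rightarrow> complex) \<Rightarrow> bool"
  where "psd_on I A \<longleftrightarrow> (\<forall>v. (\<Sum>i\<in>I. \<Sum>j\<in>I. cnj (v i) * A i j * v j) \<in> \<real>\<^sub>\<ge>\<^sub>0)"

definition psd :: "complex^'n^'n \<Rightarrow> bool"
  where "psd A \<longleftrightarrow> psd_on UNIV (\<lambda>i j. A $ i $ j)"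

text \<open>An operator on \<open>\<complex>\<^sup>n \<otimes> \<complex>\<^sup>2\<close> is an \<open>n \<times> n\<close> block matrix \<open>X\<close> with blocks \<open>X i j\<close>
  (\<open>i, j < n\<close>), and the ancilla extension \<open>\<one> \<otimes> \<Phi>\<close> applies \<open>\<Phi>\<close> to every block.\<close>

definition psd_blocks :: "nat \<Rightarrow> (nat \<Rightarrow> nat \<Rightarrow> qubit_op) \<Rightarrow> bool"
  where "psd_blocks n X \<longleftrightarrow> psd_on ({..<n} \<times> UNIV) (\<lambda>(i, a) (j, b). X i j $ a $ b)"

definition completely_positive :: "(qubit_op \<Rightarrow> qubit_op) \<Rightarrow> bool"
  where "completely_positive \<Phi> \<longleftrightarrow>
    Vector_Spaces.linear smat smat \<Phi> \<and>
    (\<forall>n X. psd_blocks n X \<longrightarrow> psd_blocks n (\<lambda>i j. \<Phi> (X i j)))"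

definition trace_preserving :: "(qubit_op \<Rightarrow> qubit_op) \<Rightarrow> bool"
  where "trace_preserving \<Phi> \<longleftrightarrow> (\<forall>A. trace (\<Phi> A) = trace A)"

definition qubit_channel :: "(qubit_op \<Rightarrow> qubit_op) \<Rightarrow> bool"
  where "qubit_channel \<Phi> \<longleftrightarrow> completely_positive \<Phi> \<and> trace_preserving \<Phi>"

definition unital :: "(qubit_op \<Rightarrow> qubit_op) \<Rightarrow> bool"
  where "unital \<Phi> \<longleftrightarrow> \<Phi> (mat 1) = mat 1"

text \<open>The tensor product of maps is given by linear extension from the matrix-unit basis; the
  lemma below shows that for linear maps it has the defining property on all product operators.\<close>

definition tensor_map ::
    "(qubit_op \<Rightarrow> qubit_op) \<Rightarrow> (qubit_op \<Rightarrow> qubit_op) \<Rightarrow> two_qubit_op \<Rightarrow> two_qubit_op"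
  where "tensor_map \<Phi>\<^sub>1 \<Phi>\<^sub>2 X =
    (\<Sum>i\<in>UNIV. \<Sum>j\<in>UNIV. \<Sum>k\<in>UNIV. \<Sum>l\<in>UNIV.
      smat (X $ (i, k) $ (j, l)) (kron (\<Phi>\<^sub>1 (mat_unit i j)) (\<Phi>\<^sub>2 (mat_unit k l))))"

lemma linear_tensor_map: "Vector_Spaces.linear smat smat (tensor_map \<Phi>\<^sub>1 \<Phi>\<^sub>2)"
  unfolding Vector_Spaces.linear_iff
  by (simp add: vector_space_smat tensor_map_def smat_def vec_eq_iff sum_2 algebra_simps)

lemma linear_smat_expand:
  assumes "Vector_Spaces.linear smat smat (\<Phi> :: qubit_op \<Rightarrow> qubit_op)"
  shows "\<Phi> A = (\<Sum>i\<in>UNIV. \<Sum>j\<in>UNIV. smat (A $ i $ j) (\<Phi> (mat_unit i j)))"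
proof -
  interpret Vector_Spaces.linear smat smat \<Phi> by (fact assms)
  have "A = (\<Sum>i\<in>UNIV. \<Sum>j\<in>UNIV. smat (A $ i $ j) (mat_unit i j))"
    by (auto simp: vec_eq_iff smat_def mat_unit_def sum_2 forall_2)
  then have "\<Phi> A = \<Phi> (\<Sum>i\<in>UNIV. \<Sum>j\<in>UNIV. smat (A $ i $ j) (mat_unit i j))"
    by simp
  also have "\<dots> = (\<Sum>i\<in>UNIV. \<Sum>j\<in>UNIV. smat (A $ i $ j) (\<Phi> (mat_unit i j)))"
    by (simp add: sum scale)
  finally show ?thesis .
qed

lemma tensor_map_kron:
  assumes "Vector_Spaces.linear smat smat \<Phi>\<^sub>1" "Vector_Spaces.linear smat smat \<Phi>\<^sub>2"
  shows "tensor_map \<Phi>\<^sub>1 \<Phi>\<^sub>2 (kron A B) = kron (\<Phi>\<^sub>1 A) (\<Phi>\<^sub>2 B)"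
  by (subst linear_smat_expand[OF assms(1), of A], subst linear_smat_expand[OF assms(2), of B])
    (simp add: tensor_map_def kron_def smat_def vec_eq_iff sum_2 algebra_simps)

definition separable :: "two_qubit_op \<Rightarrow> bool"
  where "separable X \<longleftrightarrow>
    (\<exists>(n::nat) S D. (\<forall>i<n. psd (S i) \<and> psd (D i)) \<and> X = (\<Sum>i<n. kron (S i) (D i)))"

definition entanglement_annihilating :: "(two_qubit_op \<Rightarrow> two_qubit_op) \<Rightarrow> bool"
  where "entanglement_annihilating F \<longleftrightarrow> (\<forall>\<psi>. norm \<psi> = 1 \<longrightarrow> separable (F (ketbra \<psi>)))"

abbreviation preserves_entanglement :: "(two_qubit_op \<Rightarrow> two_qubit_op) \<Rightarrow> bool"
  where "preserves_entanglement F \<equiv> \<not> entanglement_annihilating F"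

end

theory Submission
  imports Defs
begin

text \<open>In the Pauli basis a unital channel \<open>\<Lambda>\<^sub>1\<close> is a real \<open>3 \<times> 3\<close> matrix \<open>M\<close>, and some rotation \<open>R\<close> makes
  \<open>R\<^sup>T M\<close> symmetric; so for a suitable unitary \<open>U\<close> the map \<open>L = U\<^sup>* \<Lambda>\<^sub>1(_) U\<close> is self-adjoint for the
  pairing \<open>(A, B) \<mapsto> tr (A B)\<close>.  If \<open>\<Lambda>\<^sub>1 \<otimes> \<Lambda>\<^sub>2\<close> were entanglement-annihilating, then it would map the positive
  operator \<open>(\<one> \<otimes> \<Lambda>')((\<one> \<otimes> U) |s\<rangle>\<langle>s| (\<one> \<otimes> U\<^sup>*))\<close>, where \<open>s\<close> is the singlet, to some
  \<open>\<Sum>\<^sub>k S\<^sub>k \<otimes> D\<^sub>k\<close>.  Pairing the first factor with \<open>U X U\<^sup>*\<close> and moving \<open>L\<close> across the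
  singlet gives \<open>(\<Lambda>\<^sub>2 \<circ> \<Lambda>' \<circ> \<Lambda>\<^sub>1)(adj X) = \<Sum>\<^sub>k tr (S\<^sub>k U X U\<^sup>*) D\<^sub>k\<close>, because the adjugate commutes with the
  unital trace-preserving \<open>\<Lambda>\<^sub>1\<close>.  As the adjugate is a positive involution, this is a
  measure-and-prepare form of \<open>\<Lambda>\<^sub>2 \<circ> \<Lambda>' \<circ> \<Lambda>\<^sub>1\<close>, which therefore breaks entanglement.\<close>

section \<open>Positive semidefinite matrices\<close>

lemma psd_on_mono:
  assumes "psd_on I A" "J \<subseteq> I" "finite I"
  shows "psd_on J A"
  unfolding psd_on_def
proof
  fix v :: "'a \<Rightarrow> complex"
  let ?w = "\<lambda>i. if i \<in> J then v i else 0"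
  have "(\<Sum>i\<in>J. \<Sum>j\<in>J. cnj (v i) * A i j * v j) = (\<Sum>i\<in>J. \<Sum>j\<in>J. cnj (?w i) * A i j * ?w j)"
    by simp
  also have "\<dots> = (\<Sum>i\<in>J. \<Sum>j\<in>I. cnj (?w i) * A i j * ?w j)"
    by (rule sum.cong[OF refl], rule sum.mono_neutral_left) (use assms in auto)
  also have "\<dots> = (\<Sum>i\<in>I. \<Sum>j\<in>I. cnj (?w i) * A i j * ?w j)"
    by (intro sum.mono_neutral_left) (use assms in auto)
  also have "\<dots> \<in> \<real>\<^sub>\<ge>\<^sub>0"
    by (rule spec[OF assms(1)[unfolded psd_on_def], of ?w])
  finally show "(\<Sum>i\<in>J. \<Sum>j\<in>J. cnj (v i) * A i j * v j) \<in> \<real>\<^sub>\<ge>\<^sub>0" .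
qed

lemma psd_on_diag:
  assumes "psd_on I A" "finite I" "i \<in> I"
  shows "A i i \<in> \<real>\<^sub>\<ge>\<^sub>0"
proof -
  have "psd_on {i} A"
    by (rule psd_on_mono[OF assms(1)]) (use assms in auto)
  then have "cnj 1 * A i i * 1 \<in> \<real>\<^sub>\<ge>\<^sub>0"
    unfolding psd_on_def by (elim allE[of _ "\<lambda>_. 1"]) simp
  then show ?thesis by simp
qed

lemma psd_on_pair:
  assumes "psd_on I A" "finite I" "i \<in> I" "j \<in> I" "i \<noteq> j"
  shows "cnj a * A i i * a + cnj a * A i j * b + cnj b * A j i * a + cnj b * A j j * b \<in> \<real>\<^sub>\<ge>\<^sub>0"
proof -
  have "psd_on {i, j} A"
    by (rule psd_on_mono[OF assms(1)]) (use assms(2-4) in auto)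
  from spec[OF this[unfolded psd_on_def], of "\<lambda>k. if k = i then a else b"] show ?thesis
    using assms(5) by (simp add: add.assoc)
qed

text \<open>Realness of the quadratic form forces hermiticity: on the pair \<open>i\<close>,
  \<open>j\<close> the test vector (1, 1) kills the imaginary part of \<open>A i j + A j i\<close>,
  and (1, i) kills the real part of \<open>A i j - A j i\<close>.\<close>

lemma psd_on_hermitian:
  assumes "psd_on I A" "finite I" "i \<in> I" "j \<in> I"
  shows "A j i = cnj (A i j)"
proof (cases "i = j")
  case True
  then show ?thesis
    using psd_on_diag[OF assms(1,2,3)] by (simp add: complex_nonneg_Reals_iff complex_eq_iff)
next
  case False
  have diag: "Im (A i i) = 0" "Im (A j j) = 0"
    using psd_on_diag[OF assms(1,2)] assms(3,4) by (auto simp: complex_nonneg_Reals_iff)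
  have "Im (A i j) + Im (A j i) = 0"
    using psd_on_pair[OF assms False, of 1 1] diag by (simp add: complex_nonneg_Reals_iff)
  moreover have "Re (A i j) - Re (A j i) = 0"
    using psd_on_pair[OF assms False, of 1 \<i>] diag by (simp add: complex_nonneg_Reals_iff)
  ultimately show ?thesis
    by (simp add: complex_eq_iff)
qed

text \<open>With \<open>A i i = 0\<close> the form at \<open>(s * A i j, 1)\<close> is affine in the
  real number \<open>s\<close> with slope \<open>2 * ?n\<close>, so a nonzero entry would make it
  negative somewhere.\<close>

lemma psd_on_zero_diag:
  assumes "psd_on I A" "finite I" "i \<in> I" "j \<in> I" "A i i = 0"
  shows "A i j = 0"
proof (rule ccontr)
  assume nz: "A i j \<noteq> 0"
  then have ij: "i \<noteq> j"
    using assms(5) by auto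
  let ?n = "(cmod (A i j))\<^sup>2"
  have n: "?n > 0"
    using nz by simp
  \<comment> \<open>The value of \<open>s\<close> at which the form equals -1.\<close>
  define s where "s = - (Re (A j j) + 1) / (2 * ?n)"
  have e: "cnj (of_real s * A i j) * A i j = of_real (s * ?n)"
    "cnj 1 * cnj (A i j) * (of_real s * A i j) = of_real (s * ?n)"
    by (simp_all add: complex_norm_square mult.commute del: of_real_power)
  have "of_real (s * ?n) + of_real (s * ?n) + A j j \<in> \<real>\<^sub>\<ge>\<^sub>0"
    using psd_on_pair[OF assms(1-4) ij, of "of_real s * A i j" 1]
    unfolding psd_on_hermitian[OF assms(1-4)] e assms(5) by (simp del: of_real_mult)
  then have "2 * (s * ?n) + Re (A j j) \<ge> 0"
    by (simp add: complex_nonneg_Reals_iff)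
  moreover have "2 * (s * ?n) = - (Re (A j j) + 1)"
    using n nz unfolding s_def by (simp add: field_simps)
  ultimately show False
    by simp
qed

text \<open>Completing the square: the Schur complement is the form of \<open>A\<close> after the
  best choice of the coordinate at \<open>x\<close>. If \<open>A x x = 0\<close>, division by zero
  gives 0 and the correction term disappears.\<close>

lemma psd_on_schur_complement:
  assumes A: "psd_on (insert x I) A" and fin: "finite I" and x: "x \<notin> I"
  shows "psd_on I (\<lambda>i j. A i j - A i x * A x j / A x x)"
  unfolding psd_on_def
proof
  fix v :: "'a \<Rightarrow> complex"
  define u where "u = (\<Sum>j\<in>I. A x j * v j)"
  define u' where "u' = (\<Sum>i\<in>I. cnj (v i) * A i x)"
  \<comment> \<open>The stationary point of the form in the coordinate at \<open>x\<close>; it is 0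
    when \<open>A x x = 0\<close>.\<close>
  define c where "c = - u / A x x"
  let ?w = "v(x := c)"
  have cu: "cnj u = u'"
    unfolding u_def u'_def cnj_sum
    by (intro sum.cong refl)
      (simp add: psd_on_hermitian[OF A, of x] fin mult.commute)
  have Axx: "cnj (A x x) = A x x"
    by (rule psd_on_hermitian[OF A, symmetric]) (use fin in auto)
  have "(\<Sum>i\<in>insert x I. \<Sum>j\<in>insert x I. cnj (?w i) * A i j * ?w j)
      = cnj c * A x x * c + cnj c * u + u' * c + (\<Sum>i\<in>I. \<Sum>j\<in>I. cnj (v i) * A i j * v j)"
  proof -
    have "(\<Sum>i\<in>insert x I. \<Sum>j\<in>insert x I. cnj (?w i) * A i j * ?w j)
      = (cnj c * A x x * c + (\<Sum>j\<in>I. cnj c * A x j * ?w j))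
        + (\<Sum>i\<in>I. cnj (?w i) * A i x * c + (\<Sum>j\<in>I. cnj (?w i) * A i j * ?w j))"
      using fin x by simp
    also have "(\<Sum>j\<in>I. cnj c * A x j * ?w j) = cnj c * u"
      unfolding u_def sum_distrib_left by (intro sum.cong refl) (use x in auto)
    also have "(\<Sum>i\<in>I. cnj (?w i) * A i x * c + (\<Sum>j\<in>I. cnj (?w i) * A i j * ?w j))
       = (\<Sum>i\<in>I. cnj (v i) * A i x * c + (\<Sum>j\<in>I. cnj (v i) * A i j * v j))"
      by (rule sum.cong[OF refl], rule arg_cong2[where f = "(+)"]) (use x in \<open>auto intro!: sum.cong\<close>)
    also have "\<dots> = u' * c + (\<Sum>i\<in>I. \<Sum>j\<in>I. cnj (v i) * A i j * v j)"
      unfolding u'_def sum_distrib_right sum.distrib by simp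
    finally show ?thesis
      by (simp add: algebra_simps)
  qed
  also have "cnj c * A x x * c + cnj c * u + u' * c = - (u' * u / A x x)"
    unfolding c_def by (cases "A x x = 0") (simp_all add: cu Axx field_simps)
  also have "u' * u / A x x = (\<Sum>i\<in>I. \<Sum>j\<in>I. cnj (v i) * (A i x * A x j / A x x) * v j)"
    unfolding u_def u'_def sum_product sum_divide_distrib by (simp add: mult.assoc)
  also have "- (\<Sum>i\<in>I. \<Sum>j\<in>I. cnj (v i) * (A i x * A x j / A x x) * v j)
       + (\<Sum>i\<in>I. \<Sum>j\<in>I. cnj (v i) * A i j * v j)
      = (\<Sum>i\<in>I. \<Sum>j\<in>I. cnj (v i) * (A i j - A i x * A x j / A x x) * v j)"
    by (simp add: right_diff_distrib left_diff_distrib sum_subtractf)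
  finally have eq: "(\<Sum>i\<in>insert x I. \<Sum>j\<in>insert x I. cnj (?w i) * A i j * ?w j)
      = (\<Sum>i\<in>I. \<Sum>j\<in>I. cnj (v i) * (A i j - A i x * A x j / A x x) * v j)" .
  show "(\<Sum>i\<in>I. \<Sum>j\<in>I. cnj (v i) * (A i j - A i x * A x j / A x x) * v j) \<in> \<real>\<^sub>\<ge>\<^sub>0"
    using A unfolding psd_on_def eq[symmetric] by blast
qed

text \<open>Cholesky factorization: split off the rank-one matrix built from column
  \<open>x\<close>, and apply the induction hypothesis to the Schur complement on
  \<open>I\<close>.\<close>

lemma psd_on_rank_one_sum:
  assumes "finite I" "psd_on I A"
  shows "\<exists>(n::nat) v. \<forall>i\<in>I. \<forall>j\<in>I. A i j = (\<Sum>k<n. v k i * cnj (v k j))"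
  using assms
proof (induction I arbitrary: A)
  case empty
  then show ?case by simp
next
  case (insert x I)
  have herm: "A j i = cnj (A i j)" if "i \<in> insert x I" "j \<in> insert x I" for i j
    by (rule psd_on_hermitian[OF insert.prems]) (use insert.hyps that in auto)
  obtain n v where v: "\<And>i j. i \<in> I \<Longrightarrow> j \<in> I \<Longrightarrow>
      A i j - A i x * A x j / A x x = (\<Sum>k<n::nat. v k i * cnj (v k j))"
    using insert.IH[OF psd_on_schur_complement[OF insert.prems insert.hyps]] by blast
  define r where "r = sqrt (Re (A x x))"
  have Axx: "A x x = of_real (r * r)"
    using psd_on_diag[OF insert.prems, of x] insert.hyps
    by (auto simp: r_def complex_nonneg_Reals_iff complex_eq_iff)
  \<comment> \<open>The new vector, with index \<open>n\<close>, is column \<open>x\<close> divided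
    by the root of the pivot; the old ones are extended by 0 at \<open>x\<close>.\<close>
  define w where "w = (\<lambda>k i. if k = n then A i x / of_real r else if i = x then 0 else v k i)"
  \<comment> \<open>A zero pivot means that column \<open>x\<close> vanishes, so the zero vector
    produced by division by 0 is the right one.\<close>
  have col: "A i x = 0" if "i \<in> insert x I" "r = 0" for i
    using psd_on_zero_diag[OF insert.prems, of x i] herm[of x i] insert.hyps that Axx by auto
  have "A i j = (\<Sum>k<Suc n. w k i * cnj (w k j))"
    if i: "i \<in> insert x I" and j: "j \<in> insert x I" for i j
  proof -
    have last: "w n i * cnj (w n j) = A i x * A x j / A x x"
      using herm[OF j insertI1] by (simp add: w_def Axx)
    have rest: "(\<Sum>k<n. w k i * cnj (w k j)) = (if i = x \<or> j = x then 0 else \<Sum>k<n. v k i * cnj (v k j))"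
      by (auto simp: w_def intro!: sum.neutral sum.cong)
    have "A i j = A i x * A x j / A x x" if "i = x \<or> j = x"
    proof (cases "r = 0")
      case True
      have "A x j = 0"
        by (simp add: herm[OF j insertI1] col[OF j True])
      then show ?thesis
        using that col[OF i True] by auto
    next
      case False
      then have "A x x \<noteq> 0"
        using Axx by simp
      then show ?thesis
        using that by auto
    qed
    moreover have "A i j = A i x * A x j / A x x + (\<Sum>k<n. v k i * cnj (v k j))"
      if "\<not> (i = x \<or> j = x)"
      using v[of i j] i j that by (simp add: eq_diff_eq diff_eq_eq add.commute)
    ultimately show ?thesis
      unfolding sum.lessThan_Suc last rest by auto
  qed
  then show ?case by blast
qed

lemma psd_ketbra_sum:
  assumes "psd A"
  obtains n :: nat and v where "A = (\<Sum>k<n. ketbra (v k))"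
proof -
  obtain n :: nat and v where v: "\<And>i j. A $ i $ j = (\<Sum>k<n. v k i * cnj (v k j))"
    using psd_on_rank_one_sum[OF finite_class.finite_UNIV, of "\<lambda>i j. A $ i $ j"] assms
    unfolding psd_def by auto
  have "A = (\<Sum>k<n. ketbra (\<chi> i. v k i))"
    by (simp add: vec_eq_iff v ketbra_def)
  then show ?thesis by (rule that)
qed

lemma psd_hermitian: "psd A \<Longrightarrow> A $ j $ i = cnj (A $ i $ j)"
  unfolding psd_def by (rule psd_on_hermitian[of UNIV "\<lambda>i j. A $ i $ j"]) simp_all

lemma psd_smat:
  assumes "psd A" "c \<ge> 0"
  shows "psd (smat (of_real c) A)"
  unfolding psd_def psd_on_def
proof
  fix v :: "'a \<Rightarrow> complex"
  have "(\<Sum>i\<in>UNIV. \<Sum>j\<in>UNIV. cnj (v i) * (smat (of_real c) A) $ i $ j * v j)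
      = of_real c * (\<Sum>i\<in>UNIV. \<Sum>j\<in>UNIV. cnj (v i) * A $ i $ j * v j)"
    by (simp add: smat_def sum_distrib_left mult.left_commute mult.assoc)
  also have "\<dots> \<in> \<real>\<^sub>\<ge>\<^sub>0"
  proof (rule nonneg_Reals_mult_I)
    show "complex_of_real c \<in> \<real>\<^sub>\<ge>\<^sub>0"
      using assms(2) by simp
    show "(\<Sum>i\<in>UNIV. \<Sum>j\<in>UNIV. cnj (v i) * A $ i $ j * v j) \<in> \<real>\<^sub>\<ge>\<^sub>0"
      by (rule spec[OF assms(1)[unfolded psd_def psd_on_def]])
  qed
  finally show "(\<Sum>i\<in>UNIV. \<Sum>j\<in>UNIV. cnj (v i) * (smat (of_real c) A) $ i $ j * v j) \<in> \<real>\<^sub>\<ge>\<^sub>0" .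
qed

lemma psd_ketbra: "psd (ketbra \<psi>)"
  unfolding psd_def psd_on_def
proof
  fix v :: "'a \<Rightarrow> complex"
  define z where "z = (\<Sum>i\<in>UNIV. cnj (v i) * \<psi> $ i)"
  have "(\<Sum>i\<in>UNIV. \<Sum>j\<in>UNIV. cnj (v i) * ketbra \<psi> $ i $ j * v j) = z * cnj z"
    by (simp add: z_def cnj_sum sum_product ketbra_def mult_ac) (rule sum.swap)
  also have "\<dots> \<in> \<real>\<^sub>\<ge>\<^sub>0"
    by (simp add: complex_nonneg_Reals_iff)
  finally show "(\<Sum>i\<in>UNIV. \<Sum>j\<in>UNIV. cnj (v i) * ketbra \<psi> $ i $ j * v j) \<in> \<real>\<^sub>\<ge>\<^sub>0" .
qed

section \<open>Separability\<close>

lemma separable_0: "separable 0"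
  unfolding separable_def by (intro exI[of _ 0]) simp

lemma separable_kron: "psd S \<Longrightarrow> psd D \<Longrightarrow> separable (kron S D)"
  unfolding separable_def by (intro exI[of _ 1] exI[of _ "\<lambda>_. S"] exI[of _ "\<lambda>_. D"]) simp

lemma separable_add:
  assumes "separable X" "separable Y"
  shows "separable (X + Y)"
proof -
  obtain n S D where X: "\<forall>i<n. psd (S i) \<and> psd (D i)" "X = (\<Sum>i<n::nat. kron (S i) (D i))"
    using assms(1) unfolding separable_def by blast
  obtain m S' D' where Y: "\<forall>i<m. psd (S' i) \<and> psd (D' i)" "Y = (\<Sum>i<m::nat. kron (S' i) (D' i))"
    using assms(2) unfolding separable_def by blast
  let ?S = "\<lambda>i. if i < n then S i else S' (i - n)"
  let ?D = "\<lambda>i. if i < n then D i else D' (i - n)"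
  have "(\<Sum>i<n + m. kron (?S i) (?D i)) = X + Y"
    unfolding X(2) Y(2) lessThan_atLeast0
    by (subst sum.atLeastLessThan_concat[of 0 n "n + m", symmetric], simp, simp)
      (simp add: sum.shift_bounds_nat_ivl[of _ 0 n m, simplified add_0] add.commute)
  then show ?thesis
    unfolding separable_def using X(1) Y(1)
    by (intro exI[of _ "n + m"] exI[of _ ?S] exI[of _ ?D]) auto
qed

lemma separable_sum: "(\<And>k. k \<in> K \<Longrightarrow> separable (f k)) \<Longrightarrow> separable (\<Sum>k\<in>K. f k)"
  by (induction K rule: infinite_finite_induct) (auto intro: separable_0 separable_add)

lemma separable_smat:
  assumes "separable X" "c \<ge> 0"
  shows "separable (smat (of_real c) X)"
proof -
  obtain n S D where X: "\<forall>i<n. psd (S i) \<and> psd (D i)" "X = (\<Sum>i<n::nat. kron (S i) (D i))"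
    using assms(1) unfolding separable_def by blast
  have "smat (of_real c) X = (\<Sum>i<n. kron (smat (of_real c) (S i)) (D i))"
    by (simp add: X(2) smat_def kron_def vec_eq_iff sum_distrib_left mult.assoc)
  then show ?thesis
    unfolding separable_def using X(1) psd_smat[OF _ assms(2)]
    by (intro exI[of _ n] exI[of _ "\<lambda>i. smat (of_real c) (S i)"] exI[of _ D]) auto
qed

text \<open>The definition tests only normalized pure states. A positive operator is a sum of
  \<open>ketbra\<close> terms, each a nonnegative multiple of a normalized one, and separable
  operators form a convex cone.\<close>

lemma entanglement_annihilating_psd:
  assumes EA: "entanglement_annihilating F"
    and lin: "Vector_Spaces.linear smat smat F" and "psd X"
  shows "separable (F X)"
proof -
  interpret Vector_Spaces.linear smat smat F by (fact lin)
  obtain n :: nat and v where X: "X = (\<Sum>k<n. ketbra (v k))"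
    using psd_ketbra_sum[OF \<open>psd X\<close>] by blast
  have "separable (F (ketbra \<psi>))" for \<psi>
  proof (cases "\<psi> = 0")
    case True
    then have "ketbra \<psi> = 0"
      by (simp add: ketbra_def vec_eq_iff)
    then show ?thesis
      by (simp add: zero separable_0)
  next
    case False
    let ?\<phi> = "(1 / norm \<psi>) *\<^sub>R \<psi>"
    have eq: "ketbra \<psi> = smat (of_real ((norm \<psi>)\<^sup>2)) (ketbra ?\<phi>)"
      using False
      by (simp add: ketbra_def smat_def vec_eq_iff scaleR_conv_of_real[where 'a = complex] power2_eq_square)
    have "separable (F (ketbra ?\<phi>))"
      using EA False unfolding entanglement_annihilating_def by simp
    then show ?thesis
      unfolding eq scale by (intro separable_smat) auto
  qed
  then show ?thesis
    unfolding X sum by (intro separable_sum)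
qed

section \<open>Quaternions and Pauli coordinates\<close>

text \<open>A maximizer \<open>q\<close> of the form \<open>N x \<bullet> x\<close> on the unit
  sphere is an eigenvector: moving from \<open>q\<close> along the defect
  \<open>p = N q - l *\<^sub>R q\<close> would otherwise increase the Rayleigh quotient.\<close>

lemma symmetric_eigenvector:
  fixes N :: "'a::euclidean_space \<Rightarrow> 'a"
  assumes lin: "linear N" and sym: "\<And>x y. N x \<bullet> y = x \<bullet> N y"
  obtains q l where "norm q = 1" "N q = l *\<^sub>R q"
proof -
  interpret linear N by (fact lin)
  have "continuous_on (sphere 0 1) (\<lambda>x. N x \<bullet> x)"
    by (intro continuous_intros linear_continuous_on linear_conv_bounded_linear[THEN iffD1] lin)
  moreover have "sphere (0::'a) 1 \<noteq> {}"
    by simp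
  ultimately obtain q where q: "norm q = 1" and max: "\<And>x. norm x = 1 \<Longrightarrow> N x \<bullet> x \<le> N q \<bullet> q"
    using continuous_attains_sup[of "sphere (0::'a) 1" "\<lambda>x. N x \<bullet> x"] by auto
  define l where "l = N q \<bullet> q"
  \<comment> \<open>Homogeneous version of the maximality: \<open>g\<close> is nonnegative
    everywhere and vanishes at \<open>q\<close>.\<close>
  define g where "g = (\<lambda>x. l * (x \<bullet> x) - N x \<bullet> x)"
  have g_nonneg: "g x \<ge> 0" for x
  proof (cases "x = 0")
    case False
    have "N (x /\<^sub>R norm x) \<bullet> (x /\<^sub>R norm x) \<le> l"
      unfolding l_def using False by (intro max) simp
    then have "N x \<bullet> x \<le> l * (norm x)\<^sup>2"
      using False by (simp add: scale field_simps power2_eq_square)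
    then show ?thesis
      by (simp add: g_def power2_norm_eq_inner)
  qed (simp add: g_def)
  define p where "p = N q - l *\<^sub>R q"
  have qq: "q \<bullet> q = 1"
    using q by (simp add: norm_eq_1)
  have expand: "g (q + t *\<^sub>R p) = - 2 * t * (p \<bullet> p) + t\<^sup>2 * g p" for t
  proof -
    have "N q \<bullet> p = p \<bullet> p + l * (q \<bullet> p)"
      using inner_diff_left[of "N q" "l *\<^sub>R q" p] by (simp flip: p_def)
    moreover have "N p \<bullet> q = N q \<bullet> p"
      using sym[of p q] by (simp only: inner_commute[of "N q" p])
    ultimately show ?thesis
      unfolding g_def
      by (simp add: add scale inner_add_left inner_add_right qq l_def[symmetric] inner_commute[of p q]
          power2_eq_square algebra_simps)
  qed
  have "p \<bullet> p = 0"
  proof (rule ccontr)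
    assume "p \<bullet> p \<noteq> 0"
    then have pp: "p \<bullet> p > 0"
      by simp
    \<comment> \<open>Small enough for the linear term of \<open>expand\<close> to dominate; the 1
      keeps the denominator positive when \<open>g p = 0\<close>.\<close>
    define t where "t = (p \<bullet> p) / (g p + 1)"
    have t: "t > 0" "t * (g p + 1) = p \<bullet> p"
      using pp g_nonneg[of p] by (auto simp: t_def)
    have "0 \<le> t * (t * g p - 2 * (p \<bullet> p))"
      using g_nonneg[of "q + t *\<^sub>R p"] unfolding expand by (simp add: algebra_simps power2_eq_square)
    then have "t * g p \<ge> 2 * (p \<bullet> p)"
      using t(1) by (simp add: zero_le_mult_iff)
    then show False
      using t pp by (simp add: algebra_simps)
  qed
  then have "N q = l *\<^sub>R q"
    by (simp add: p_def)
  with q show ?thesis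
    by (rule that)
qed

text \<open>The three equations say that \<open>R\<^sup>T M\<close> is symmetric, where \<open>R\<close> is the rotation of the
  quaternion \<open>(a, b, c, d)\<close>.  Maximizing \<open>tr (R\<^sup>T M)\<close>, a quadratic form in the quaternion, makes
  it an eigenvector of the symmetric \<open>4 \<times> 4\<close> matrix \<open>N\<close> of this form.\<close>

lemma quaternion_symmetrizes:
  fixes M :: "real^3^3"
  obtains a b c d :: real where "a\<^sup>2 + b\<^sup>2 + c\<^sup>2 + d\<^sup>2 = 1"
    "(a\<^sup>2 + b\<^sup>2 - c\<^sup>2 - d\<^sup>2) * M$1$2 + 2 * (b * c - a * d) * M$2$2 + 2 * (b * d + a * c) * M$3$2
      = 2 * (b * c + a * d) * M$1$1 + (a\<^sup>2 - b\<^sup>2 + c\<^sup>2 - d\<^sup>2) * M$2$1 + 2 * (c * d - a * b) * M$3$1"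
    "2 * (b * c + a * d) * M$1$3 + (a\<^sup>2 - b\<^sup>2 + c\<^sup>2 - d\<^sup>2) * M$2$3 + 2 * (c * d - a * b) * M$3$3
      = 2 * (b * d - a * c) * M$1$2 + 2 * (c * d + a * b) * M$2$2 + (a\<^sup>2 - b\<^sup>2 - c\<^sup>2 + d\<^sup>2) * M$3$2"
    "2 * (b * d - a * c) * M$1$1 + 2 * (c * d + a * b) * M$2$1 + (a\<^sup>2 - b\<^sup>2 - c\<^sup>2 + d\<^sup>2) * M$3$1
      = (a\<^sup>2 + b\<^sup>2 - c\<^sup>2 - d\<^sup>2) * M$1$3 + 2 * (b * c - a * d) * M$2$3 + 2 * (b * d + a * c) * M$3$3"
proof -
  define T where "T = M$1$1 + M$2$2 + M$3$3"
  define z1 where "z1 = M$2$3 - M$3$2"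
  define z2 where "z2 = M$3$1 - M$1$3"
  define z3 where "z3 = M$1$2 - M$2$1"
  define N :: "real \<times> real \<times> real \<times> real \<Rightarrow> real \<times> real \<times> real \<times> real"
    where "N = (\<lambda>(a, b, c, d).
      (T * a + z1 * b + z2 * c + z3 * d,
       z1 * a + (2 * M$1$1 - T) * b + (M$1$2 + M$2$1) * c + (M$1$3 + M$3$1) * d,
       z2 * a + (M$1$2 + M$2$1) * b + (2 * M$2$2 - T) * c + (M$2$3 + M$3$2) * d,
       z3 * a + (M$1$3 + M$3$1) * b + (M$2$3 + M$3$2) * c + (2 * M$3$3 - T) * d))"
  have "linear N"
    by (rule linearI) (auto simp: N_def algebra_simps)
  moreover have "N x \<bullet> y = x \<bullet> N y" for x y
    by (cases x, cases y) (simp add: N_def algebra_simps)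
  ultimately obtain q l where q: "norm q = 1" "N q = l *\<^sub>R q"
    by (rule symmetric_eigenvector)
  obtain a b c d where abcd: "q = (a, b, c, d)"
    by (cases q)
  have unit: "a\<^sup>2 + b\<^sup>2 + c\<^sup>2 + d\<^sup>2 = 1"
    using q(1) unfolding abcd norm_eq_1 by (simp add: power2_eq_square add.assoc)
  define w0 where "w0 = T * a + z1 * b + z2 * c + z3 * d"
  define w1 where "w1 = z1 * a + (2 * M$1$1 - T) * b + (M$1$2 + M$2$1) * c + (M$1$3 + M$3$1) * d"
  define w2 where "w2 = z2 * a + (M$1$2 + M$2$1) * b + (2 * M$2$2 - T) * c + (M$2$3 + M$3$2) * d"
  define w3 where "w3 = z3 * a + (M$1$3 + M$3$1) * b + (M$2$3 + M$3$2) * c + (2 * M$3$3 - T) * d"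
  have w: "w0 = l * a" "w1 = l * b" "w2 = l * c" "w3 = l * d"
    using q(2) unfolding abcd N_def w0_def w1_def w2_def w3_def by simp_all
  note defs = T_def z1_def z2_def z3_def w0_def w1_def w2_def w3_def
  \<comment> \<open>These are the imaginary components of the quaternion product of
    \<open>N q\<close> with the conjugate of \<open>q\<close>, which is real since
    \<open>N q = l *\<^sub>R q\<close>. Expanded, they are exactly the three differences of mirrored
    entries that must vanish.\<close>
  have "(a * w3 - w0 * d) - (w1 * c - w2 * b) = 0" "(a * w1 - w0 * b) - (w2 * d - w3 * c) = 0"
    "(a * w2 - w0 * c) - (w3 * b - w1 * d) = 0"
    by (simp_all add: w)
  then show ?thesis
    by (intro that[of a b c d] unit)
      (simp_all only: defs, simp_all add: power2_eq_square algebra_simps)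
qed

text \<open>The operator with coordinates \<open>t\<close>, \<open>x\<close>, \<open>y\<close>,
  \<open>z\<close> with respect to the identity and the three Pauli matrices. Complex coordinates
  reach every operator; real ones give the hermitian operators.\<close>

definition pauli :: "complex \<Rightarrow> complex \<Rightarrow> complex \<Rightarrow> complex \<Rightarrow> qubit_op"
  where "pauli t x y z = (\<chi> i j. if i = 1 then if j = 1 then t + z else x - \<i> * y
                                 else if j = 1 then x + \<i> * y else t - z)"

lemma pauli_nth [simp]:
  "pauli t x y z $ 1 $ 1 = t + z" "pauli t x y z $ 1 $ 2 = x - \<i> * y"
  "pauli t x y z $ 2 $ 1 = x + \<i> * y" "pauli t x y z $ 2 $ 2 = t - z"
  by (simp_all add: pauli_def)

lemma pauli_cases:
  obtains t x y z where "A = pauli t x y z"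
proof
  show "A = pauli ((A$1$1 + A$2$2) / 2) ((A$1$2 + A$2$1) / 2) (\<i> * (A$1$2 - A$2$1) / 2)
      ((A$1$1 - A$2$2) / 2)"
    by (simp add: vec_eq_iff forall_2 field_simps)
qed

lemma trace_pauli_mult:
  "trace (pauli t x y z ** pauli t' x' y' z') = 2 * (t * t' + x * x' + y * y' + z * z')"
  by (simp add: trace_def matrix_matrix_mult_def sum_2 algebra_simps)

definition dagger :: "complex^'n^'m \<Rightarrow> complex^'m^'n"
  where "dagger A = (\<chi> i j. cnj (A $ j $ i))"

lemma dagger_pauli: "dagger (pauli t x y z) = pauli (cnj t) (cnj x) (cnj y) (cnj z)"
  by (simp add: dagger_def vec_eq_iff forall_2)

lemma mat_eq_pauli: "mat c = pauli c 0 0 0"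
  by (simp add: vec_eq_iff forall_2 mat_def)

text \<open>The double cover of SO(3) by SU(2): a unit quaternion is a unitary \<open>U\<close>, and
  conjugation by it rotates the Pauli vector. The rotation's rows are the coefficients in
  \<open>quaternion_symmetrizes\<close>.\<close>

lemma unitary_conj_pauli:
  fixes a b c d :: real
  assumes "U = pauli (of_real a) (\<i> * of_real b) (\<i> * of_real c) (\<i> * of_real d)"
    and "a\<^sup>2 + b\<^sup>2 + c\<^sup>2 + d\<^sup>2 = 1"
  shows "dagger U ** U = mat 1" "U ** dagger U = mat 1"
    and "dagger U ** pauli t x y z ** U = pauli t
      (of_real (a\<^sup>2 + b\<^sup>2 - c\<^sup>2 - d\<^sup>2) * x + of_real (2 * (b * c - a * d)) * y + of_real (2 * (b * d + a * c)) * z)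
      (of_real (2 * (b * c + a * d)) * x + of_real (a\<^sup>2 - b\<^sup>2 + c\<^sup>2 - d\<^sup>2) * y + of_real (2 * (c * d - a * b)) * z)
      (of_real (2 * (b * d - a * c)) * x + of_real (2 * (c * d + a * b)) * y + of_real (a\<^sup>2 - b\<^sup>2 - c\<^sup>2 + d\<^sup>2) * z)"
proof -
  have "complex_of_real (a\<^sup>2 + b\<^sup>2 + c\<^sup>2 + d\<^sup>2) = 1"
    by (simp only: assms of_real_1)
  then have unit: "complex_of_real a * a = 1 - of_real b * b - of_real c * c - of_real d * d"
    by (simp add: power2_eq_square algebra_simps)
  show 1: "dagger U ** U = mat 1" "U ** dagger U = mat 1"
    unfolding assms(1) dagger_pauli mat_eq_pauli
    by (simp_all add: vec_eq_iff forall_2 matrix_matrix_mult_def sum_2 algebra_simps unit)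
  show "dagger U ** pauli t x y z ** U = pauli t
      (of_real (a\<^sup>2 + b\<^sup>2 - c\<^sup>2 - d\<^sup>2) * x + of_real (2 * (b * c - a * d)) * y + of_real (2 * (b * d + a * c)) * z)
      (of_real (2 * (b * c + a * d)) * x + of_real (a\<^sup>2 - b\<^sup>2 + c\<^sup>2 - d\<^sup>2) * y + of_real (2 * (c * d - a * b)) * z)
      (of_real (2 * (b * d - a * c)) * x + of_real (2 * (c * d + a * b)) * y + of_real (a\<^sup>2 - b\<^sup>2 - c\<^sup>2 + d\<^sup>2) * z)"
    (is "_ = pauli t ?x ?y ?z")
  proof -
    \<comment> \<open>Without normalization the identity is homogeneous in the quaternion, and its
      squared norm shows up only in the coordinate \<open>t\<close>.\<close>
    have "dagger U ** pauli t x y z ** U = pauli (of_real (a\<^sup>2 + b\<^sup>2 + c\<^sup>2 + d\<^sup>2) * t) ?x ?y ?z"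
      unfolding assms(1) dagger_pauli
      by (simp add: vec_eq_iff forall_2 matrix_matrix_mult_def sum_2 power2_eq_square algebra_simps)
    then show ?thesis
      by (simp add: assms(2) del: of_real_add of_real_power)
  qed
qed

section \<open>Completely positive maps\<close>

lemma completely_positive_linear:
  "completely_positive \<Phi> \<Longrightarrow> Vector_Spaces.linear smat smat \<Phi>"
  unfolding completely_positive_def by blast

text \<open>Translates between the numbered ancilla of \<open>psd_blocks\<close> and matrices
  indexed by types.\<close>

lemma psd_on_reindex:
  assumes "bij_betw h J I"
  shows "psd_on J (\<lambda>p q. A (h p) (h q)) \<longleftrightarrow> psd_on I A"
proof -
  have eq: "(\<Sum>p\<in>J. \<Sum>q\<in>J. cnj (v (h p)) * A (h p) (h q) * v (h q))
      = (\<Sum>i\<in>I. \<Sum>j\<in>I. cnj (v i) * A i j * v j)" for v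
    using sum.reindex_bij_betw[OF assms, of "\<lambda>i. \<Sum>j\<in>I. cnj (v i) * A i j * v j"]
      sum.reindex_bij_betw[OF assms, of "\<lambda>j. cnj (v i) * A i j * v j" for i]
    by simp
  show ?thesis
  proof
    assume *: "psd_on J (\<lambda>p q. A (h p) (h q))"
    show "psd_on I A"
      unfolding psd_on_def eq[symmetric]
      by (intro allI spec[OF *[unfolded psd_on_def]])
  next
    assume *: "psd_on I A"
    show "psd_on J (\<lambda>p q. A (h p) (h q))"
      unfolding psd_on_def
    proof
      fix v :: "_ \<Rightarrow> complex"
      define u where "u = v \<circ> inv_into J h"
      have "u (h p) = v p" if "p \<in> J" for p
        using that assms by (simp add: u_def bij_betw_def)
      then have "(\<Sum>p\<in>J. \<Sum>q\<in>J. cnj (v p) * A (h p) (h q) * v q)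
          = (\<Sum>p\<in>J. \<Sum>q\<in>J. cnj (u (h p)) * A (h p) (h q) * u (h q))"
        by simp
      then show "(\<Sum>p\<in>J. \<Sum>q\<in>J. cnj (v p) * A (h p) (h q) * v q) \<in> \<real>\<^sub>\<ge>\<^sub>0"
        using * unfolding eq psd_on_def by simp
    qed
  qed
qed

lemma psd_blocks_reindex:
  assumes "bij_betw e {..<n} (UNIV :: 'm set)"
  shows "psd_blocks n (\<lambda>i j. X (e i) (e j))
    \<longleftrightarrow> psd_on UNIV (\<lambda>p q. X (fst p) (fst q) $ snd p $ snd q)"
proof -
  have "bij_betw (map_prod e id) ({..<n} \<times> UNIV) (UNIV \<times> UNIV)"
    by (intro bij_betw_map_prod assms bij_betw_id)
  from psd_on_reindex[OF this, of "\<lambda>p q. X (fst p) (fst q) $ snd p $ snd q"] show ?thesis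
    unfolding psd_blocks_def by (simp add: case_prod_unfold)
qed

lemma completely_positive_psd:
  assumes "completely_positive \<Phi>" "psd A"
  shows "psd (\<Phi> A)"
proof -
  \<comment> \<open>Positivity is complete positivity with a one-dimensional ancilla.\<close>
  have blocks: "psd_blocks 1 (\<lambda>i j. B) \<longleftrightarrow> psd B" for B :: qubit_op
  proof -
    have "bij_betw (\<lambda>a. (0::nat, a)) UNIV ({..<1} \<times> UNIV)"
      by (auto simp: bij_betw_def inj_on_def)
    from psd_on_reindex[OF this, of "\<lambda>(i, a) (j, b). B $ a $ b"] show ?thesis
      unfolding psd_blocks_def psd_def by simp
  qed
  show ?thesis
    using assms blocks unfolding completely_positive_def by blast
qed

lemma psd_tensor_map_id:
  assumes "completely_positive \<Phi>" "psd X"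
  shows "psd (tensor_map id \<Phi> X)"
proof -
  \<comment> \<open>The first qubit serves as a two-dimensional ancilla: \<open>B\<close> lists the
    blocks of \<open>X\<close>, and \<open>e\<close> numbers their indices from 0.\<close>
  define B :: "2 \<Rightarrow> 2 \<Rightarrow> qubit_op" where "B = (\<lambda>i j. \<chi> a b. X $ (i, a) $ (j, b))"
  define e :: "nat \<Rightarrow> 2" where "e = (\<lambda>i. if i = 0 then 1 else 2)"
  have "bij_betw e {..<2} UNIV"
    by (auto simp: bij_betw_def inj_on_def e_def lessThan_nat_numeral lessThan_Suc UNIV_2)
  note reindex = psd_blocks_reindex[OF this]
  have "psd_blocks 2 (\<lambda>i j. B (e i) (e j))"
    unfolding reindex using assms(2) by (simp add: B_def psd_def)
  then have "psd_blocks 2 (\<lambda>i j. \<Phi> (B (e i) (e j)))"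
    using assms(1) unfolding completely_positive_def by blast
  moreover have "\<Phi> (B i j) $ a $ b = tensor_map id \<Phi> X $ (i, a) $ (j, b)" for i j a b
    using exhaust_2[of i] exhaust_2[of j]
    by (subst linear_smat_expand[OF completely_positive_linear[OF assms(1)]])
      (auto simp: B_def tensor_map_def smat_def kron_def mat_unit_def sum_2)
  ultimately show ?thesis
    unfolding reindex[of "\<lambda>i j. \<Phi> (B i j)"] psd_def by simp
qed

lemma tensor_map_comp_id:
  assumes "Vector_Spaces.linear smat smat \<Phi>\<^sub>1" "Vector_Spaces.linear smat smat \<Phi>\<^sub>2"
  shows "tensor_map \<Phi>\<^sub>1 \<Phi>\<^sub>2 (tensor_map id \<Psi> X) = tensor_map \<Phi>\<^sub>1 (\<Phi>\<^sub>2 \<circ> \<Psi>) X"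
proof -
  interpret Vector_Spaces.linear smat smat "tensor_map \<Phi>\<^sub>1 \<Phi>\<^sub>2" by (rule linear_tensor_map)
  show ?thesis
    unfolding tensor_map_def[of id] tensor_map_def[of _ "\<Phi>\<^sub>2 \<circ> \<Psi>"]
    by (simp add: sum scale tensor_map_kron[OF assms])
qed

section \<open>Partial traces and adjugates\<close>

text \<open>The partial trace over the first factor of \<open>(W \<otimes> \<one>) Z\<close>.\<close>

definition slice :: "qubit_op \<Rightarrow> two_qubit_op \<Rightarrow> qubit_op"
  where "slice W Z = (\<chi> a b. \<Sum>i\<in>UNIV. \<Sum>j\<in>UNIV. W $ j $ i * Z $ (i, a) $ (j, b))"

lemma linear_slice: "Vector_Spaces.linear smat smat (slice W)"
  unfolding Vector_Spaces.linear_iff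
  by (simp add: vector_space_smat slice_def smat_def vec_eq_iff sum_2 algebra_simps)

lemma slice_kron: "slice W (kron A B) = smat (trace (A ** W)) B"
  by (simp add: slice_def kron_def smat_def vec_eq_iff sum_2 trace_def matrix_matrix_mult_def
      algebra_simps)

text \<open>Duality: a map on the traced-out factor can be moved onto the test operator. By
  linearity it suffices to check this on products of matrix units.\<close>

lemma slice_tensor_map:
  assumes "Vector_Spaces.linear smat smat \<Phi>\<^sub>2"
    and adj: "\<And>A. trace (\<Phi>\<^sub>1 A ** W) = trace (A ** W')"
  shows "slice W (tensor_map \<Phi>\<^sub>1 \<Phi>\<^sub>2 Z) = \<Phi>\<^sub>2 (slice W' Z)"
proof -
  interpret s: Vector_Spaces.linear smat smat "slice W" by (rule linear_slice)
  interpret s': Vector_Spaces.linear smat smat "slice W'" by (rule linear_slice)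
  interpret f: Vector_Spaces.linear smat smat \<Phi>\<^sub>2 by (fact assms)
  \<comment> \<open>Tensoring two identities is the expansion of \<open>Z\<close> in matrix
    units.\<close>
  have Z: "Z = tensor_map id id Z"
    by (simp add: tensor_map_def vec_eq_iff sum_2 forall_2 smat_def kron_def mat_unit_def)
  have "\<Phi>\<^sub>2 (slice W' Z) = \<Phi>\<^sub>2 (slice W' (tensor_map id id Z))"
    by (simp flip: Z)
  then show ?thesis
    unfolding tensor_map_def
    by (simp add: s.sum s.scale s'.sum s'.scale f.sum f.scale slice_kron adj)
qed

text \<open>For 2 by 2 matrices this is the classical adjugate; it reverses the Pauli vector. In
  this form it visibly commutes with unital trace-preserving linear maps.\<close>

definition adjugate :: "qubit_op \<Rightarrow> qubit_op"
  where "adjugate A = mat (trace A) - A"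

lemma adjugate_adjugate: "adjugate (adjugate A) = A"
  by (simp add: adjugate_def vec_eq_iff forall_2 mat_def trace_def sum_2)

lemma trace_mult_adjugate: "trace (A ** adjugate B) = trace (adjugate A ** B)"
  by (simp add: adjugate_def mat_def trace_def sum_2 matrix_matrix_mult_def algebra_simps)

lemma psd_adjugate:
  assumes "psd A"
  shows "psd (adjugate A)"
  unfolding psd_def psd_on_def
proof
  fix v :: "2 \<Rightarrow> complex"
  \<comment> \<open>A vector orthogonal to \<open>v\<close>: the adjugate exchanges the two
    directions.\<close>
  let ?w = "\<lambda>i. if i = 1 then cnj (v 2) else - cnj (v 1)"
  have "(\<Sum>i\<in>UNIV. \<Sum>j\<in>UNIV. cnj (v i) * adjugate A $ i $ j * v j)
      = (\<Sum>i\<in>UNIV. \<Sum>j\<in>UNIV. cnj (?w i) * A $ i $ j * ?w j)"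
    by (simp add: sum_2 adjugate_def mat_def trace_def algebra_simps)
  also have "\<dots> \<in> \<real>\<^sub>\<ge>\<^sub>0"
    by (rule spec[OF assms[unfolded psd_def psd_on_def], of ?w])
  finally show "(\<Sum>i\<in>UNIV. \<Sum>j\<in>UNIV. cnj (v i) * adjugate A $ i $ j * v j) \<in> \<real>\<^sub>\<ge>\<^sub>0" .
qed

lemma psd_conj:
  fixes A V :: qubit_op
  assumes "psd A"
  shows "psd (dagger V ** A ** V)"
  unfolding psd_def psd_on_def
proof
  fix v :: "2 \<Rightarrow> complex"
  let ?w = "\<lambda>i. \<Sum>j\<in>UNIV. V $ i $ j * v j"
  have "(\<Sum>i\<in>UNIV. \<Sum>j\<in>UNIV. cnj (v i) * (dagger V ** A ** V) $ i $ j * v j)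
      = (\<Sum>i\<in>UNIV. \<Sum>j\<in>UNIV. cnj (?w i) * A $ i $ j * ?w j)"
    by (simp add: sum_2 dagger_def matrix_matrix_mult_def algebra_simps)
  also have "\<dots> \<in> \<real>\<^sub>\<ge>\<^sub>0"
    by (rule spec[OF assms[unfolded psd_def psd_on_def], of ?w])
  finally show "(\<Sum>i\<in>UNIV. \<Sum>j\<in>UNIV. cnj (v i) * (dagger V ** A ** V) $ i $ j * v j) \<in> \<real>\<^sub>\<ge>\<^sub>0" .
qed

text \<open>Here \<open>\<psi>\<close> is the unnormalized singlet with \<open>U\<close> applied to
  its second qubit; contracting the first qubit of the singlet with \<open>W\<close> leaves the
  adjugate of \<open>W\<close> on the second.\<close>

lemma slice_singlet:
  assumes "\<psi> = (\<chi> p. if fst p = 1 then U $ snd p $ 2 else - U $ snd p $ 1)"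
  shows "slice W (ketbra \<psi>) = U ** adjugate W ** dagger U"
  by (simp add: assms slice_def ketbra_def vec_eq_iff forall_2 sum_2 adjugate_def mat_def trace_def
      dagger_def matrix_matrix_mult_def algebra_simps)

text \<open>Measuring the second qubit leaves the first in an unnormalized conditional state
  \<open>S k\<close>, and the prepared \<open>D k\<close> is uncorrelated with it beyond the outcome
  \<open>k\<close>.\<close>

lemma measure_and_prepare_annihilates:
  assumes \<Psi>: "\<And>X. \<Psi> X = (\<Sum>k<n::nat. smat (trace (T k ** X)) (D k))"
    and psd: "\<And>k. k < n \<Longrightarrow> psd (T k)" "\<And>k. k < n \<Longrightarrow> psd (D k)"
  shows "entanglement_annihilating (tensor_map id \<Psi>)"
  unfolding entanglement_annihilating_def
proof (intro allI impI)
  fix \<psi> :: "complex^(2 \<times> 2)"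
  \<comment> \<open>The partial trace over the second qubit of the state multiplied by
    \<open>T k\<close> on that qubit.\<close>
  define S where "S = (\<lambda>k. \<chi> i j. \<Sum>a\<in>UNIV. \<Sum>b\<in>UNIV. \<psi> $ (i, a) * cnj (\<psi> $ (j, b)) * T k $ b $ a)"
  have "tensor_map id \<Psi> (ketbra \<psi>) = (\<Sum>k<n. kron (S k) (D k))"
    by (simp add: tensor_map_def \<Psi> S_def vec_eq_iff forall_2 sum_2 smat_def kron_def mat_unit_def
        ketbra_def trace_def matrix_matrix_mult_def sum_distrib_left sum_distrib_right
        distrib_left distrib_right sum.distrib mult.assoc)
  moreover have "psd (S k)" if "k < n" for k
    unfolding psd_def psd_on_def
  proof
    fix v :: "2 \<Rightarrow> complex"
    let ?w = "\<lambda>b. \<Sum>i\<in>UNIV. cnj (v i) * \<psi> $ (i, b)"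
    have "(\<Sum>i\<in>UNIV. \<Sum>j\<in>UNIV. cnj (v i) * S k $ i $ j * v j)
        = (\<Sum>i\<in>UNIV. \<Sum>j\<in>UNIV. cnj (?w i) * T k $ i $ j * ?w j)"
      by (simp add: sum_2 S_def algebra_simps)
    also have "\<dots> \<in> \<real>\<^sub>\<ge>\<^sub>0"
      by (rule spec[OF psd(1)[OF that, unfolded psd_def psd_on_def], of ?w])
    finally show "(\<Sum>i\<in>UNIV. \<Sum>j\<in>UNIV. cnj (v i) * S k $ i $ j * v j) \<in> \<real>\<^sub>\<ge>\<^sub>0" .
  qed
  ultimately show "separable (tensor_map id \<Psi> (ketbra \<psi>))"
    using psd(2) by (auto intro!: separable_sum separable_kron)
qed

section \<open>Unital qubit channels\<close>

lemma psd_pauli_cases: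
  assumes "psd A"
  obtains x y z :: real where "A = pauli (trace A / 2) (of_real x) (of_real y) (of_real z)"
proof
  have 1: "Im (A$1$1) = 0" "Im (A$2$2) = 0" "A$2$1 = cnj (A$1$2)"
    using psd_hermitian[OF assms, of 1 1] psd_hermitian[OF assms, of 2 2]
      psd_hermitian[OF assms, of 2 1] by (simp_all add: complex_eq_iff)
  then show "A = pauli (trace A / 2) (of_real (Re (A$1$2))) (of_real (- Im (A$1$2)))
      (of_real (Re (A$1$1 - A$2$2) / 2))"
    by (simp add: vec_eq_iff forall_2 trace_def sum_2 complex_eq_iff field_simps)
qed

text \<open>Positivity of a channel says something only about positive operators, so the identity
  plus a Pauli matrix, a rank-one operator, replaces the Pauli matrix itself.\<close>

lemma psd_pauli_axes: "psd (pauli 1 1 0 0)" "psd (pauli 1 0 1 0)" "psd (pauli 1 0 0 1)"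
proof -
  have eq: "pauli 1 1 0 0 = ketbra (\<chi> i. 1)" "pauli 1 0 1 0 = ketbra (\<chi> i. if i = 1 then 1 else \<i>)"
    "pauli 1 0 0 1 = ketbra (\<chi> i. if i = 1 then of_real (sqrt 2) else 0)"
    by (simp_all add: vec_eq_iff forall_2 ketbra_def flip: of_real_mult)
  show "psd (pauli 1 1 0 0)" "psd (pauli 1 0 1 0)" "psd (pauli 1 0 0 1)"
    unfolding eq by (rule psd_ketbra)+
qed

text \<open>Trace preservation and unitality decouple \<open>t\<close> from the Pauli vector;
  positivity makes the images of the axis operators hermitian, hence the matrix real.\<close>

lemma unital_channel_pauli:
  assumes "qubit_channel \<Lambda>" "unital \<Lambda>"
  obtains M :: "real^3^3" where "\<And>t x y z. \<Lambda> (pauli t x y z) = pauli t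
    (of_real (M$1$1) * x + of_real (M$1$2) * y + of_real (M$1$3) * z)
    (of_real (M$2$1) * x + of_real (M$2$2) * y + of_real (M$2$3) * z)
    (of_real (M$3$1) * x + of_real (M$3$2) * y + of_real (M$3$3) * z)"
proof -
  have cp: "completely_positive \<Lambda>" and tr: "\<And>A. trace (\<Lambda> A) = trace A"
    using assms(1) by (auto simp: qubit_channel_def trace_preserving_def)
  interpret Vector_Spaces.linear smat smat \<Lambda>
    by (rule completely_positive_linear[OF cp])
  have one: "\<Lambda> (pauli 1 0 0 0) = pauli 1 0 0 0"
    using assms(2) by (simp add: unital_def mat_eq_pauli)
  have axis: "\<exists>x y z :: real. \<Lambda> P = pauli 1 (of_real x) (of_real y) (of_real z)"
    if "psd P" "trace P = 2" for P
    using psd_pauli_cases[OF completely_positive_psd[OF cp that(1)]] that(2) tr[of P] by force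
  have trace2: "trace (pauli 1 x y z) = 2" for x y z
    by (simp add: trace_def sum_2)
  obtain x1 y1 z1 x2 y2 z2 x3 y3 z3 :: real where
    1: "\<Lambda> (pauli 1 1 0 0) = pauli 1 (of_real x1) (of_real y1) (of_real z1)" and
    2: "\<Lambda> (pauli 1 0 1 0) = pauli 1 (of_real x2) (of_real y2) (of_real z2)" and
    3: "\<Lambda> (pauli 1 0 0 1) = pauli 1 (of_real x3) (of_real y3) (of_real z3)"
    using axis[OF psd_pauli_axes(1) trace2] axis[OF psd_pauli_axes(2) trace2]
      axis[OF psd_pauli_axes(3) trace2] by auto
  \<comment> \<open>The columns are the Pauli vectors of the images of the three axis
    operators.\<close>
  define M :: "real^3^3" where "M = vector [vector [x1, x2, x3], vector [y1, y2, y3], vector [z1, z2, z3]]"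
  have "\<Lambda> (pauli t x y z) = pauli t
    (of_real (M$1$1) * x + of_real (M$1$2) * y + of_real (M$1$3) * z)
    (of_real (M$2$1) * x + of_real (M$2$2) * y + of_real (M$2$3) * z)
    (of_real (M$3$1) * x + of_real (M$3$2) * y + of_real (M$3$3) * z)" for t x y z
  proof -
    \<comment> \<open>Each axis operator contains the identity once, hence the coefficient
      \<open>t - x - y - z\<close>.\<close>
    have decomp: "pauli t x y z = smat (t - x - y - z) (pauli 1 0 0 0) + smat x (pauli 1 1 0 0)
        + smat y (pauli 1 0 1 0) + smat z (pauli 1 0 0 1)"
      by (simp add: vec_eq_iff forall_2 smat_def algebra_simps)
    have "\<Lambda> (pauli t x y z) = smat (t - x - y - z) (\<Lambda> (pauli 1 0 0 0)) + smat x (\<Lambda> (pauli 1 1 0 0))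
        + smat y (\<Lambda> (pauli 1 0 1 0)) + smat z (\<Lambda> (pauli 1 0 0 1))"
      unfolding decomp by (simp only: add scale)
    then show ?thesis
      unfolding one 1 2 3
      by (simp add: M_def vector_3 vec_eq_iff forall_2 smat_def algebra_simps)
  qed
  then show ?thesis
    by (rule that)
qed

text \<open>The trace pairing is twice the dot product of Pauli coordinates, so self-adjointness
  means a symmetric coordinate matrix; conjugation by \<open>U\<close> supplies the symmetrizing
  rotation.\<close>

lemma unital_channel_symmetrizable:
  assumes "qubit_channel \<Lambda>" "unital \<Lambda>"
  obtains U :: qubit_op where "dagger U ** U = mat 1" "U ** dagger U = mat 1"
    "\<And>A B. trace (A ** (dagger U ** \<Lambda> B ** U)) = trace ((dagger U ** \<Lambda> A ** U) ** B)"
proof -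
  obtain M :: "real^3^3" where M: "\<And>t x y z. \<Lambda> (pauli t x y z) = pauli t
    (of_real (M$1$1) * x + of_real (M$1$2) * y + of_real (M$1$3) * z)
    (of_real (M$2$1) * x + of_real (M$2$2) * y + of_real (M$2$3) * z)
    (of_real (M$3$1) * x + of_real (M$3$2) * y + of_real (M$3$3) * z)"
    using unital_channel_pauli[OF assms] by blast
  obtain a b c d :: real where unit: "a\<^sup>2 + b\<^sup>2 + c\<^sup>2 + d\<^sup>2 = 1" and sym:
    "(a\<^sup>2 + b\<^sup>2 - c\<^sup>2 - d\<^sup>2) * M$1$2 + 2 * (b * c - a * d) * M$2$2 + 2 * (b * d + a * c) * M$3$2
      = 2 * (b * c + a * d) * M$1$1 + (a\<^sup>2 - b\<^sup>2 + c\<^sup>2 - d\<^sup>2) * M$2$1 + 2 * (c * d - a * b) * M$3$1"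
    "2 * (b * c + a * d) * M$1$3 + (a\<^sup>2 - b\<^sup>2 + c\<^sup>2 - d\<^sup>2) * M$2$3 + 2 * (c * d - a * b) * M$3$3
      = 2 * (b * d - a * c) * M$1$2 + 2 * (c * d + a * b) * M$2$2 + (a\<^sup>2 - b\<^sup>2 - c\<^sup>2 + d\<^sup>2) * M$3$2"
    "2 * (b * d - a * c) * M$1$1 + 2 * (c * d + a * b) * M$2$1 + (a\<^sup>2 - b\<^sup>2 - c\<^sup>2 + d\<^sup>2) * M$3$1
      = (a\<^sup>2 + b\<^sup>2 - c\<^sup>2 - d\<^sup>2) * M$1$3 + 2 * (b * c - a * d) * M$2$3 + 2 * (b * d + a * c) * M$3$3"
    by (rule quaternion_symmetrizes[of M])
  define U where "U = pauli (of_real a) (\<i> * of_real b) (\<i> * of_real c) (\<i> * of_real d)"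
  note conj = unitary_conj_pauli[OF U_def unit]
  \<comment> \<open>Entry \<open>j\<close> of the row \<open>(r1, r2, r3)\<close> times
    \<open>M\<close>; thus \<open>k1\<close>, \<open>k2\<close>, \<open>k3\<close> below are the
    rows of the rotated matrix.\<close>
  define k where "k = (\<lambda>r1 r2 r3 j. complex_of_real (r1 * M$1$j + r2 * M$2$j + r3 * M$3$j))"
  have row: "of_real r1 * (of_real (M$1$1) * x + of_real (M$1$2) * y + of_real (M$1$3) * z)
      + of_real r2 * (of_real (M$2$1) * x + of_real (M$2$2) * y + of_real (M$2$3) * z)
      + of_real r3 * (of_real (M$3$1) * x + of_real (M$3$2) * y + of_real (M$3$3) * z)
      = k r1 r2 r3 1 * x + k r1 r2 r3 2 * y + k r1 r2 r3 3 * z" for r1 r2 r3 x y z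
    by (simp add: k_def algebra_simps)
  define k1 where "k1 = k (a\<^sup>2 + b\<^sup>2 - c\<^sup>2 - d\<^sup>2) (2 * (b * c - a * d)) (2 * (b * d + a * c))"
  define k2 where "k2 = k (2 * (b * c + a * d)) (a\<^sup>2 - b\<^sup>2 + c\<^sup>2 - d\<^sup>2) (2 * (c * d - a * b))"
  define k3 where "k3 = k (2 * (b * d - a * c)) (2 * (c * d + a * b)) (a\<^sup>2 - b\<^sup>2 - c\<^sup>2 + d\<^sup>2)"
  have k: "k1 2 = k2 1" "k2 3 = k3 2" "k3 1 = k1 3"
    unfolding k1_def k2_def k3_def k_def using sym by (simp_all only:)
  have L: "dagger U ** \<Lambda> (pauli t x y z) ** U = pauli t (k1 1 * x + k1 2 * y + k1 3 * z)
      (k2 1 * x + k2 2 * y + k2 3 * z) (k3 1 * x + k3 2 * y + k3 3 * z)" for t x y z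
    unfolding M conj(3) row k1_def k2_def k3_def ..
  have "trace (A ** (dagger U ** \<Lambda> B ** U)) = trace ((dagger U ** \<Lambda> A ** U) ** B)" for A B
  proof -
    obtain t x y z where A: "A = pauli t x y z"
      by (rule pauli_cases)
    obtain t' x' y' z' where B: "B = pauli t' x' y' z'"
      by (rule pauli_cases)
    show ?thesis
      unfolding A B L trace_pauli_mult k by (simp add: algebra_simps)
  qed
  then show ?thesis
    by (rule that[OF conj(1,2)])
qed

lemma adjugate_conj:
  assumes "V ** U = mat 1" "U ** V = mat 1"
  shows "adjugate (V ** A ** U) = V ** adjugate A ** U"
proof -
  have "trace (V ** A ** U) = trace A"
    by (metis assms(2) matrix_mul_assoc matrix_mul_rid trace_mul_sym)
  moreover have "V ** (mat c - A) ** U = V ** mat c ** U - V ** A ** U" for c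
    by (simp add: vec_eq_iff matrix_matrix_mult_def sum_2 algebra_simps)
  moreover have "V ** mat c ** U = mat c" for c
  proof -
    have "V ** mat c = mat c ** V"
      by (simp add: vec_eq_iff forall_2 matrix_matrix_mult_def mat_def sum_2)
    then show ?thesis
      by (metis assms(1) matrix_mul_assoc matrix_mul_rid)
  qed
  ultimately show ?thesis
    by (simp add: adjugate_def)
qed

theorem proposition1:
  fixes \<Lambda>\<^sub>1 \<Lambda>\<^sub>2 \<Lambda>' :: "qubit_op \<Rightarrow> qubit_op"
  assumes "qubit_channel \<Lambda>\<^sub>1" and "unital \<Lambda>\<^sub>1"
    and "qubit_channel \<Lambda>\<^sub>2"
    and "completely_positive \<Lambda>'"
    and "preserves_entanglement (tensor_map id (\<Lambda>\<^sub>2 \<circ> \<Lambda>' \<circ> \<Lambda>\<^sub>1))"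
  shows "preserves_entanglement (tensor_map \<Lambda>\<^sub>1 \<Lambda>\<^sub>2)"
proof
  assume EA: "entanglement_annihilating (tensor_map \<Lambda>\<^sub>1 \<Lambda>\<^sub>2)"
  have lin1: "Vector_Spaces.linear smat smat \<Lambda>\<^sub>1" and lin2: "Vector_Spaces.linear smat smat \<Lambda>\<^sub>2"
    and lin': "Vector_Spaces.linear smat smat \<Lambda>'"
    using assms(1,3,4) by (auto simp: qubit_channel_def completely_positive_linear)
  have tr1: "trace (\<Lambda>\<^sub>1 A) = trace A" for A
    using assms(1) by (simp add: qubit_channel_def trace_preserving_def)
  interpret l1: Vector_Spaces.linear smat smat \<Lambda>\<^sub>1 by (fact lin1)
  have lin: "Vector_Spaces.linear smat smat (\<Lambda>\<^sub>2 \<circ> \<Lambda>')"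
    by (rule Vector_Spaces.linear_compose[OF lin' lin2])
  obtain U where U: "dagger U ** U = mat 1" "U ** dagger U = mat 1" and
    sym: "\<And>A B. trace (A ** (dagger U ** \<Lambda>\<^sub>1 B ** U)) = trace ((dagger U ** \<Lambda>\<^sub>1 A ** U) ** B)"
    using unital_channel_symmetrizable[OF assms(1,2)] by blast
  \<comment> \<open>The rotated singlet is left unnormalized, which
    \<open>entanglement_annihilating_psd\<close> allows.\<close>
  define \<psi> :: "complex^(2 \<times> 2)"
    where "\<psi> = (\<chi> p. if fst p = 1 then U $ snd p $ 2 else - U $ snd p $ 1)"
  have "separable (tensor_map \<Lambda>\<^sub>1 \<Lambda>\<^sub>2 (tensor_map id \<Lambda>' (ketbra \<psi>)))"
    by (intro entanglement_annihilating_psd[OF EA] linear_tensor_map psd_tensor_map_id assms(4) psd_ketbra)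
  then obtain n S D where SD: "\<And>k. k < n \<Longrightarrow> psd (S k)" "\<And>k. k < n \<Longrightarrow> psd (D k)"
    and eq: "tensor_map \<Lambda>\<^sub>1 (\<Lambda>\<^sub>2 \<circ> \<Lambda>') (ketbra \<psi>) = (\<Sum>k<n::nat. kron (S k) (D k))"
    unfolding separable_def tensor_map_comp_id[OF lin1 lin2] by blast
  have adj1: "\<Lambda>\<^sub>1 (adjugate X) = adjugate (\<Lambda>\<^sub>1 X)" for X
  proof -
    have "\<Lambda>\<^sub>1 (mat c) = mat c" for c
    proof -
      have "mat c = smat c (mat 1 :: qubit_op)"
        by (simp add: mat_def smat_def vec_eq_iff)
      then show ?thesis
        using assms(2) by (simp add: l1.scale unital_def)
    qed
    then show ?thesis
      by (simp add: adjugate_def l1.diff tr1)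
  qed
  have \<Psi>: "(\<Lambda>\<^sub>2 \<circ> \<Lambda>' \<circ> \<Lambda>\<^sub>1) X = (\<Sum>k<n. smat (trace (adjugate (dagger U ** S k ** U) ** X)) (D k))" for X
  proof -
    define Y where "Y = adjugate X"
    \<comment> \<open>Chosen so that \<open>cyc\<close> and \<open>sym\<close> turn pairing
      \<open>\<Lambda>\<^sub>1 A\<close> with \<open>W\<close> into pairing \<open>A\<close> with
      \<open>dagger U ** \<Lambda>\<^sub>1 Y ** U\<close>.\<close>
    define W where "W = U ** Y ** dagger U"
    interpret s: Vector_Spaces.linear smat smat "slice W" by (rule linear_slice)
    have cyc: "trace (A ** W) = trace ((dagger U ** A ** U) ** Y)" for A
      unfolding W_def by (metis matrix_mul_assoc trace_mul_sym)
    \<comment> \<open>The singlet's adjugate cancels the one in \<open>Y\<close>, and its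
      \<open>U\<close> cancels the symmetrizing conjugation.\<close>
    have "U ** adjugate (dagger U ** \<Lambda>\<^sub>1 Y ** U) ** dagger U = \<Lambda>\<^sub>1 X"
    proof -
      have "adjugate (dagger U ** \<Lambda>\<^sub>1 Y ** U) = dagger U ** adjugate (\<Lambda>\<^sub>1 Y) ** U"
        by (rule adjugate_conj[OF U])
      moreover have "adjugate (\<Lambda>\<^sub>1 Y) = \<Lambda>\<^sub>1 X"
        unfolding adj1[symmetric] Y_def adjugate_adjugate ..
      ultimately show ?thesis
        using U(2) by (metis matrix_mul_assoc matrix_mul_lid matrix_mul_rid)
    qed
    then have "(\<Lambda>\<^sub>2 \<circ> \<Lambda>' \<circ> \<Lambda>\<^sub>1) X = (\<Lambda>\<^sub>2 \<circ> \<Lambda>') (slice (dagger U ** \<Lambda>\<^sub>1 Y ** U) (ketbra \<psi>))"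
      unfolding slice_singlet[OF \<psi>_def] by simp
    also have "\<dots> = slice W (tensor_map \<Lambda>\<^sub>1 (\<Lambda>\<^sub>2 \<circ> \<Lambda>') (ketbra \<psi>))"
      by (rule slice_tensor_map[OF lin, symmetric]) (simp only: cyc sym)
    also have "\<dots> = (\<Sum>k<n. smat (trace (S k ** W)) (D k))"
      unfolding eq by (simp add: s.sum slice_kron)
    \<comment> \<open>Cycling \<open>U\<close> and moving the adjugate from \<open>X\<close> onto
      the conjugated \<open>S k\<close> exposes the measurement operators, which stay
      positive.\<close>
    finally show ?thesis
      unfolding cyc Y_def trace_mult_adjugate .
  qed
  have "entanglement_annihilating (tensor_map id (\<Lambda>\<^sub>2 \<circ> \<Lambda>' \<circ> \<Lambda>\<^sub>1))"
    by (rule measure_and_prepare_annihilates[OF \<Psi>]) (auto intro!: psd_adjugate psd_conj SD)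
  with assms(5) show False
    by contradiction
qed

end
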